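(* Let $\mathcal{A},\mathcal{B}\in\mathbb{C}^{\mathbf{N}(n)\times\mathbf{N}(n)}$ be core tensors. Then $(\mathcal{A}\otimes\mathcal{B})^{\mathrm{core}}=\mathcal{A}^{\mathrm{core}}\otimes\mathcal{B}^{\mathrm{core}}$.
   Context: Here $\mathbf{N}(n)=N_1\times\cdots\times N_n$ and $\mathbb{C}^{\mathbf{N}(n)\times\mathbf{N}(n)}$ is the set of complex tensors $\mathcal{A}=(a_{i_1\ldots i_n j_1\ldots j_n})$ with $1\le i_k,j_k\le N_k$. The Einstein product is $(\mathcal{A}*_n\mathcal{B})_{i_1\ldots i_n j_1\ldots j_n}=\sum_{k_1,\ldots,k_n}a_{i_1\ldots i_n k_1\ldots k_n}b_{k_1\ldots k_n j_1\ldots j_n}$, powers are taken with respect to it, and $\mathcal{A}^*$ is the conjugate transpose (swap row and column multi-indices and conjugate). With $\mathscr{R}(\mathcal{A})=\{\mathcal{A}*_n\mathcal{X}:\mathcal{X}\in\mathbb{C}^{\mathbf{N}(n)}\}$, the index $\mathrm{ind}(\mathcal{A})$ is the smallest positive integer $k$ with $\mathscr{R}(\mathcal{A}^k)=\mathscr{R}(\mathcal{A}^{k+1})$; $\mathcal{A}$ is a core tensor if $\mathrm{ind}(\mathcal{A})=1$. The core inverse $\mathcal{A}^{\mathrm{core}}$ is the tensor $\mathcal{X}$ (unique when it exists; it exists when $\mathcal{A}$ is a core tensor) with $(\mathcal{A}*_n\mathcal{X})^*=\mathcal{A}*_n\mathcal{X}$, $\mathcal{X}*_n\mathcal{A}^2=\mathcal{A}$,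 $\mathcal{A}*_n\mathcal{X}^2=\mathcal{X}$. The Kronecker product $\mathcal{A}\otimes\mathcal{B}=(a_{i_1\ldots i_nj_1\ldots j_n}\mathcal{B})$ is the block tensor whose $(t_1,t_2)$ subblock is $a_{i_1\ldots i_nj_1\ldots j_n}\mathcal{B}$, where $t_1=i_n+\sum_{K=1}^{n-1}\bigl[(i_K-1)\prod_{L=K+1}^{n}N_L\bigr]$ and $t_2=j_n+\sum_{K=1}^{n-1}\bigl[(j_K-1)\prod_{L=K+1}^{n}N_L\bigr]$; that is, its entry with row index (block $\mathbf{i}$, inner $\mathbf{k}$) and column index (block $\mathbf{j}$, inner $\mathbf{l}$) is $a_{\mathbf{i}\mathbf{j}}b_{\mathbf{k}\mathbf{l}}$. The Einstein product, conjugate transpose and core inverse for Kronecker products are taken with respect to these full (block, inner) row and column indices. *)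

theory Defs
  imports Complex_Main "HOL-Library.FuncSet"
begin

text \<open>
  A tensor whose rows and columns are both indexed by a finite set \<open>I\<close> is a function of two
  indices that vanishes outside \<open>I \<times> I\<close>; thus HOL equality of such functions is entrywise equality
  on \<open>I \<times> I\<close>. The set \<open>I\<close> is kept general because it is instantiated twice: to the
  multi-indices of \<open>N\<^sub>1 \<times> \<dots> \<times> N\<^sub>n\<close> for the factors, and to the pairs (block multi-index, inner
  multi-index) for Kronecker products.
\<close>

definition multi_indices :: "nat \<Rightarrow> (nat \<Rightarrow> nat) \<Rightarrow> (nat \<Rightarrow> nat) set" where
  "multi_indices n N = (\<Pi>\<^sub>E k\<in>{1..n}. {1..N k})"

type_synonym 'i tensor = "'i \<Rightarrow> 'i \<Rightarrow> complex"

definition tensors :: "'i set \<Rightarrow> 'i tensor set" where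
  "tensors I = {A. \<forall>i j. i \<notin> I \<or> j \<notin> I \<longrightarrow> A i j = 0}"

definition tensor_vectors :: "'i set \<Rightarrow> ('i \<Rightarrow> complex) set" where
  "tensor_vectors I = {X. \<forall>i. i \<notin> I \<longrightarrow> X i = 0}"

definition einstein :: "'i set \<Rightarrow> 'i tensor \<Rightarrow> 'i tensor \<Rightarrow> 'i tensor" where
  "einstein I A B = (\<lambda>i j. \<Sum>k\<in>I. A i k * B k j)"

definition einstein_vec :: "'i set \<Rightarrow> 'i tensor \<Rightarrow> ('i \<Rightarrow> complex) \<Rightarrow> ('i \<Rightarrow> complex)" where
  "einstein_vec I A X = (\<lambda>i. \<Sum>k\<in>I. A i k * X k)"

definition unit_tensor :: "'i set \<Rightarrow> 'i tensor" where
  "unit_tensor I = (\<lambda>i j. if i \<in> I \<and> i = j then 1 else 0)"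

primrec tensor_power :: "'i set \<Rightarrow> 'i tensor \<Rightarrow> nat \<Rightarrow> 'i tensor" where
  "tensor_power I A 0 = unit_tensor I"
| "tensor_power I A (Suc k) = einstein I (tensor_power I A k) A"

definition conj_transpose :: "'i tensor \<Rightarrow> 'i tensor" where
  "conj_transpose A = (\<lambda>i j. cnj (A j i))"

definition tensor_range :: "'i set \<Rightarrow> 'i tensor \<Rightarrow> ('i \<Rightarrow> complex) set" where
  "tensor_range I A = {einstein_vec I A X | X. X \<in> tensor_vectors I}"

definition tensor_ind :: "'i set \<Rightarrow> 'i tensor \<Rightarrow> nat" where
  "tensor_ind I A =
     (LEAST k. 0 < k \<and> tensor_range I (tensor_power I A k) = tensor_range I (tensor_power I A (k + 1)))"

definition core_tensor :: "'i set \<Rightarrow> 'i tensor \<Rightarrow> bool" where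
  "core_tensor I A \<longleftrightarrow> tensor_ind I A = 1"

definition is_core_inverse :: "'i set \<Rightarrow> 'i tensor \<Rightarrow> 'i tensor \<Rightarrow> bool" where
  "is_core_inverse I A X \<longleftrightarrow>
     X \<in> tensors I \<and>
     conj_transpose (einstein I A X) = einstein I A X \<and>
     einstein I X (tensor_power I A 2) = A \<and>
     einstein I A (tensor_power I X 2) = X"

definition core_inverse :: "'i set \<Rightarrow> 'i tensor \<Rightarrow> 'i tensor" where
  "core_inverse I A = (THE X. is_core_inverse I A X)"

text \<open>
  A row (or column) index of a Kronecker product is a pair of a block index and an inner index.
  Blocks are labelled by multi-indices instead of by their position numbers. The function
  \<open>block_number\<close> below is the usual numbering; it is a bijection from the multi-indices onto
  \<open>{1..N\<^sub>1\<cdots>N\<^sub>n}\<close>, so the two labellings carry the same information, and the subblock at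
  position \<open>(block_number i, block_number j)\<close> is \<open>A i j\<close> times \<open>B\<close>.
\<close>

definition kronecker :: "'i tensor \<Rightarrow> 'k tensor \<Rightarrow> ('i \<times> 'k) tensor" where
  "kronecker A B = (\<lambda>(i, k) (j, l). A i j * B k l)"

definition block_number :: "nat \<Rightarrow> (nat \<Rightarrow> nat) \<Rightarrow> (nat \<Rightarrow> nat) \<Rightarrow> nat" where
  "block_number n N i = i n + (\<Sum>K = 1..n-1. (i K - 1) * (\<Prod>L = K+1..n. N L))"

definition subblock ::
  "nat \<Rightarrow> (nat \<Rightarrow> nat) \<Rightarrow> ((nat \<Rightarrow> nat) \<times> 'k) tensor \<Rightarrow> nat \<Rightarrow> nat \<Rightarrow> 'k tensor" where
  "subblock n N T t1 t2 =
     (\<lambda>k l. T (inv_into (multi_indices n N) (block_number n N) t1, k)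
              (inv_into (multi_indices n N) (block_number n N) t2, l))"

lemma block_number_Suc:
  assumes "1 \<le> n" and "1 \<le> i n"
  shows "block_number (Suc n) N i = i (Suc n) + (block_number n N i - 1) * N (Suc n)"
proof -
  have P: "(\<Prod>L = K+1..Suc n. N L) = (\<Prod>L = K+1..n. N L) * N (Suc n)" if "K \<le> n" for K
    using that by simp
  have "(\<Sum>K = 1..n. (i K - 1) * (\<Prod>L = K+1..Suc n. N L))
      = (\<Sum>K = 1..n. (i K - 1) * (\<Prod>L = K+1..n. N L)) * N (Suc n)"
    unfolding sum_distrib_right by (rule sum.cong) (simp_all add: P mult.assoc)
  also have "(\<Sum>K = 1..n. (i K - 1) * (\<Prod>L = K+1..n. N L))
      = (\<Sum>K = 1..n-1. (i K - 1) * (\<Prod>L = K+1..n. N L)) + (i n - 1)"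
    using assms(1) by (cases n) simp_all
  also have "\<dots> = block_number n N i - 1"
    using assms(2) by (simp add: block_number_def)
  finally show ?thesis
    by (simp add: block_number_def)
qed

lemma block_number_range:
  assumes "1 \<le> n" and "\<And>k. k \<in> {1..n} \<Longrightarrow> i k \<in> {1..N k}"
  shows "block_number n N i \<in> {1..\<Prod>k = 1..n. N k}"
  using assms
proof (induction n rule: dec_induct)
  case base
  then show ?case by (simp add: block_number_def)
next
  case (step n)
  let ?b = "block_number n N i" and ?P = "\<Prod>k = 1..n. N k"
  have b: "1 \<le> ?b" "?b \<le> ?P" using step by auto
  have i: "1 \<le> i n" "1 \<le> i (Suc n)" "i (Suc n) \<le> N (Suc n)"
    using step.prems[of n] step.prems[of "Suc n"] step.hyps by auto
  have "i (Suc n) + (?b - 1) * N (Suc n) \<le> N (Suc n) + (?b - 1) * N (Suc n)"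
    using i by simp
  also have "\<dots> = ?b * N (Suc n)"
    using b(1) by (cases ?b) simp_all
  also have "\<dots> \<le> ?P * N (Suc n)"
    using b(2) by (rule mult_right_mono) simp
  finally show ?case
    using i step.hyps by (simp add: block_number_Suc)
qed

lemma block_number_inj:
  assumes "1 \<le> n" and "\<And>k. k \<in> {1..n} \<Longrightarrow> i k \<in> {1..N k}"
    and "\<And>k. k \<in> {1..n} \<Longrightarrow> j k \<in> {1..N k}"
    and "block_number n N i = block_number n N j"
  shows "\<forall>k\<in>{1..n}. i k = j k"
  using assms
proof (induction n rule: dec_induct)
  case base
  then show ?case by (simp add: block_number_def)
next
  case (step n)
  let ?M = "N (Suc n)" and ?b = "block_number n N i" and ?c = "block_number n N j"
  have i: "1 \<le> i n" "1 \<le> i (Suc n)" "i (Suc n) \<le> ?M"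
    using step.prems(1)[of n] step.prems(1)[of "Suc n"] step.hyps by auto
  have j: "1 \<le> j n" "1 \<le> j (Suc n)" "j (Suc n) \<le> ?M"
    using step.prems(2)[of n] step.prems(2)[of "Suc n"] step.hyps by auto
  have "i (Suc n) + (?b - 1) * ?M = j (Suc n) + (?c - 1) * ?M"
    using step.prems(3) step.hyps i(1) j(1) by (simp add: block_number_Suc)
  then have eq: "(i (Suc n) - 1) + (?b - 1) * ?M = (j (Suc n) - 1) + (?c - 1) * ?M"
    using i(2) j(2) by linarith
  have lt: "i (Suc n) - 1 < ?M" "j (Suc n) - 1 < ?M"
    using i j by linarith+
  have "i (Suc n) - 1 = ((i (Suc n) - 1) + (?b - 1) * ?M) mod ?M"
    using lt(1) by simp
  also have "\<dots> = ((j (Suc n) - 1) + (?c - 1) * ?M) mod ?M"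
    by (simp only: eq)
  also have "\<dots> = j (Suc n) - 1"
    using lt(2) by simp
  finally have last': "i (Suc n) - 1 = j (Suc n) - 1" .
  then have last: "i (Suc n) = j (Suc n)" using i(2) j(2) by linarith
  from eq last' have "(?b - 1) * ?M = (?c - 1) * ?M" by linarith
  moreover have "?M \<noteq> 0" using lt(1) by linarith
  ultimately have "?b - 1 = ?c - 1" by (simp only: mult_cancel2) blast
  moreover have "1 \<le> ?b" "1 \<le> ?c"
    using block_number_range[of n i N] block_number_range[of n j N] step.prems step.hyps by auto
  ultimately have "?b = ?c" by linarith
  then have "\<forall>k\<in>{1..n}. i k = j k"
    using step.prems(1,2) by (intro step.IH) simp_all
  with last show ?case by (auto simp: le_Suc_eq)
qed

lemma bij_betw_block_number:
  assumes "1 \<le> n"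
  shows "bij_betw (block_number n N) (multi_indices n N) {1..\<Prod>k = 1..n. N k}"
proof -
  have inj: "inj_on (block_number n N) (multi_indices n N)"
  proof (rule inj_onI)
    fix i j
    assume ij: "i \<in> multi_indices n N" "j \<in> multi_indices n N"
      "block_number n N i = block_number n N j"
    then have "\<forall>k\<in>{1..n}. i k = j k"
      by (intro block_number_inj[OF assms]) (auto simp: multi_indices_def PiE_iff)
    with ij(1,2) show "i = j"
      unfolding multi_indices_def by (intro PiE_ext) auto
  qed
  have sub: "block_number n N ` multi_indices n N \<subseteq> {1..\<Prod>k = 1..n. N k}"
    using assms
    by (intro image_subsetI block_number_range) (auto simp: multi_indices_def PiE_iff)
  have "card (block_number n N ` multi_indices n N) = card {1..\<Prod>k = 1..n. N k}"
    by (simp add: card_image[OF inj]) (simp add: multi_indices_def card_PiE)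
  with sub have "block_number n N ` multi_indices n N = {1..\<Prod>k = 1..n. N k}"
    by (intro card_subset_eq) simp_all
  with inj show ?thesis by (simp add: bij_betw_def)
qed

lemma subblock_kronecker:
  assumes "1 \<le> n" and "i \<in> multi_indices n N" and "j \<in> multi_indices n N"
  shows "subblock n N (kronecker A B) (block_number n N i) (block_number n N j)
       = (\<lambda>k l. A i j * B k l)"
  using bij_betw_imp_inj_on[OF bij_betw_block_number[OF assms(1), of N]] assms(2,3)
  by (simp add: subblock_def kronecker_def inv_into_f_f)

end

theory Submission
  imports Defs
begin

text \<open>
  The Kronecker product is multiplicative, \<open>(A \<otimes> B)(C \<otimes> D) = AC \<otimes> BD\<close>, and commutes with the
  conjugate transpose. Hence, if \<open>X\<close> and \<open>Y\<close> satisfy the three defining equations of a core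
  inverse for \<open>A\<close> and \<open>B\<close>, then \<open>X \<otimes> Y\<close> satisfies them for \<open>A \<otimes> B\<close> (lemma
  \<open>is_core_inverse_kronecker\<close>). Core inverses are unique by a purely algebraic computation (lemma
  \<open>is_core_inverse_unique\<close>), so the theorem reduces to the existence of core inverses of core
  tensors.

  Existence rests on one finite-dimensional fact: the powers of \<open>A\<close> are linearly dependent, and
  solving a dependency for its lowest term gives \<open>A\<^sup>k = A\<^sup>k\<^sup>+\<^sup>1 R\<close> where \<open>R\<close> is a polynomial in \<open>A\<close>
  (lemma \<open>tensor_power_drop\<close>). This fact is used three times.

  \<^item> The chain of ranges of the powers becomes stationary. So the index is a minimum over a nonempty
    set, and \<open>ind A = 1\<close> does say that \<open>A\<close> and \<open>A\<^sup>2\<close> have the same range, that is, \<open>A = A\<^sup>2 Y\<close>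
    for some \<open>Y\<close>.
  \<^item> From \<open>A = A\<^sup>2 Y\<close> follows \<open>A = A\<^sup>k Y\<^sup>k\<^sup>-\<^sup>1\<close>, and then \<open>A\<^sup>2 R = A\<close> with \<open>R\<close> commuting with \<open>A\<close>.
  \<^item> For the Hermitian tensor \<open>H = A\<^sup>* A\<close>, left factors \<open>H\<close> and \<open>A\<^sup>*\<close> can be cancelled, which turns
    \<open>H\<^sup>k = H\<^sup>k\<^sup>+\<^sup>1 R'\<close> into \<open>A = A R' H\<close>. Its conjugate transpose says that \<open>Z = R'\<^sup>* A\<^sup>*\<close> solves the
    normal equation \<open>A\<^sup>* A Z = A\<^sup>*\<close>, so that \<open>A Z\<close> is Hermitian and \<open>A Z A = A\<close>.

  The core inverse of \<open>A\<close> is then \<open>A R Z\<close>.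
\<close>

section \<open>Algebra of the Einstein product\<close>

lemma einstein_assoc: "einstein I (einstein I A B) C = einstein I A (einstein I B C)"
proof (intro ext)
  fix i j
  have "(\<Sum>k\<in>I. (\<Sum>l\<in>I. A i l * B l k) * C k j) = (\<Sum>k\<in>I. \<Sum>l\<in>I. A i l * B l k * C k j)"
    by (simp add: sum_distrib_right)
  also have "\<dots> = (\<Sum>l\<in>I. \<Sum>k\<in>I. A i l * B l k * C k j)"
    by (rule sum.swap)
  also have "\<dots> = (\<Sum>l\<in>I. A i l * (\<Sum>k\<in>I. B l k * C k j))"
    by (simp add: sum_distrib_left mult.assoc)
  finally show "einstein I (einstein I A B) C i j = einstein I A (einstein I B C) i j"
    by (simp add: einstein_def)
qed

lemma einstein_vec_assoc:
  "einstein_vec I (einstein I A B) X = einstein_vec I A (einstein_vec I B X)"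
  using einstein_assoc[of I A B "\<lambda>i _. X i"]
  by (simp add: einstein_def einstein_vec_def fun_eq_iff)

lemma einstein_diff_right:
  "einstein I A (\<lambda>i j. B i j - C i j) = (\<lambda>i j. einstein I A B i j - einstein I A C i j)"
  by (simp add: einstein_def sum_subtractf right_diff_distrib)

lemma einstein_sum_right:
  "einstein I A (\<lambda>i j. \<Sum>l\<in>L. c l * F l i j) = (\<lambda>i j. \<Sum>l\<in>L. c l * einstein I A (F l) i j)"
  unfolding einstein_def sum_distrib_left
  by (intro ext, subst sum.swap) (simp add: algebra_simps)

lemma einstein_sum_left:
  "einstein I (\<lambda>i j. \<Sum>l\<in>L. c l * F l i j) A = (\<lambda>i j. \<Sum>l\<in>L. c l * einstein I (F l) A i j)"
  unfolding einstein_def sum_distrib_left sum_distrib_right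
  by (intro ext, subst sum.swap) (simp add: algebra_simps)

lemma einstein_in_tensors:
  "A \<in> tensors I \<Longrightarrow> B \<in> tensors I \<Longrightarrow> einstein I A B \<in> tensors I"
  by (auto simp: tensors_def einstein_def)

lemma unit_in_tensors: "unit_tensor I \<in> tensors I"
  by (auto simp: tensors_def unit_tensor_def)

lemma tensor_power_in_tensors: "A \<in> tensors I \<Longrightarrow> tensor_power I A k \<in> tensors I"
  by (induction k) (auto simp: unit_in_tensors einstein_in_tensors)

lemma einstein_unit_left:
  assumes "finite I" "A \<in> tensors I"
  shows "einstein I (unit_tensor I) A = A"
proof (intro ext)
  fix i j
  have "einstein I (unit_tensor I) A i j = (\<Sum>k\<in>I. if k = i then A i j else 0)"
    unfolding einstein_def by (rule sum.cong) (auto simp: unit_tensor_def)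
  also have "\<dots> = A i j"
    using assms by (auto simp: tensors_def)
  finally show "einstein I (unit_tensor I) A i j = A i j" .
qed

lemma einstein_unit_right:
  assumes "finite I" "A \<in> tensors I"
  shows "einstein I A (unit_tensor I) = A"
proof (intro ext)
  fix i j
  have "einstein I A (unit_tensor I) i j = (\<Sum>k\<in>I. if k = j then A i j else 0)"
    unfolding einstein_def by (rule sum.cong) (auto simp: unit_tensor_def)
  also have "\<dots> = A i j"
    using assms by (auto simp: tensors_def)
  finally show "einstein I A (unit_tensor I) i j = A i j" .
qed

lemma tensor_power_2:
  assumes "finite I" "A \<in> tensors I"
  shows "tensor_power I A 2 = einstein I A A"
  using assms by (simp add: numeral_2_eq_2 einstein_unit_left)

lemma tensor_power_Suc_left:
  assumes "finite I" "A \<in> tensors I"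
  shows "tensor_power I A (Suc k) = einstein I A (tensor_power I A k)"
proof (induction k)
  case 0
  then show ?case using assms by (simp add: einstein_unit_left einstein_unit_right)
next
  case (Suc k)
  then show ?case by (simp add: einstein_assoc)
qed

lemma tensor_power_add:
  assumes "finite I" "A \<in> tensors I"
  shows "tensor_power I A (k + l) = einstein I (tensor_power I A k) (tensor_power I A l)"
  using assms
  by (induction l) (simp_all add: einstein_unit_right tensor_power_in_tensors einstein_assoc)

lemma conj_transpose_einstein:
  "conj_transpose (einstein I A B) = einstein I (conj_transpose B) (conj_transpose A)"
  by (simp add: conj_transpose_def einstein_def fun_eq_iff mult.commute)

lemma conj_transpose_conj_transpose: "conj_transpose (conj_transpose A) = A"
  by (simp add: conj_transpose_def)

lemma conj_transpose_in_tensors: "A \<in> tensors I \<Longrightarrow> conj_transpose A \<in> tensors I"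
  by (auto simp: tensors_def conj_transpose_def)

text \<open>The left factor \<open>A\<^sup>*\<close> of \<open>A\<^sup>* A B\<close> can be cancelled, because \<open>D\<^sup>* D = 0\<close> implies \<open>D = 0\<close>.\<close>

lemma conj_transpose_cancel:
  assumes "finite I" "A \<in> tensors I"
    and eq: "einstein I (conj_transpose A) (einstein I A B) =
             einstein I (conj_transpose A) (einstein I A C)"
  shows "einstein I A B = einstein I A C"
proof -
  define E where "E = (\<lambda>i j. B i j - C i j)"
  define D where "D = einstein I A E"
  have D: "D = (\<lambda>i j. einstein I A B i j - einstein I A C i j)"
    by (simp add: D_def E_def einstein_diff_right)
  have "einstein I (conj_transpose A) D = (\<lambda>_ _. 0)"
    by (simp add: D einstein_diff_right eq)
  then have DD: "einstein I (conj_transpose D) D = (\<lambda>_ _. 0)"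
    unfolding D_def conj_transpose_einstein einstein_assoc by (simp add: einstein_def)
  have "D i j = 0" for i j
  proof (cases "i \<in> I")
    case True
    \<comment> \<open>The diagonal of \<open>D\<^sup>* D\<close> consists of the squared norms of the columns of \<open>D\<close>.\<close>
    have "complex_of_real (\<Sum>k\<in>I. (cmod (D k j))\<^sup>2) = einstein I (conj_transpose D) D j j"
      by (simp add: einstein_def conj_transpose_def complex_norm_square mult.commute
          del: of_real_power)
    then have "(\<Sum>k\<in>I. (cmod (D k j))\<^sup>2) = 0"
      using DD by (simp del: of_real_sum)
    then show ?thesis
      using True assms(1) by (simp add: sum_nonneg_eq_0_iff)
  next
    case False
    then show ?thesis using assms(2) by (simp add: D_def einstein_def tensors_def)
  qed
  then show ?thesis by (simp add: D fun_eq_iff)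
qed

text \<open>For Hermitian \<open>H\<close>, \<open>H\<^sup>k\<^sup>+\<^sup>2 = H\<^sup>* (H H\<^sup>k)\<close>, so the previous lemma removes one factor at a time.\<close>

lemma hermitian_power_cancel:
  assumes "finite I" "H \<in> tensors I" "conj_transpose H = H"
    and "einstein I (tensor_power I H (Suc k)) B = einstein I (tensor_power I H (Suc k)) C"
  shows "einstein I H B = einstein I H C"
  using assms(4)
proof (induction k)
  case 0
  then show ?case using assms(1,2) by (simp add: einstein_unit_left)
next
  case (Suc k)
  have P: "tensor_power I H (Suc (Suc k)) = einstein I H (einstein I H (tensor_power I H k))"
    using assms(1,2) by (simp only: tensor_power_Suc_left)
  have "einstein I H (einstein I (tensor_power I H k) B) =
        einstein I H (einstein I (tensor_power I H k) C)"
    using Suc.prems unfolding P einstein_assoc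
    by (intro conj_transpose_cancel[OF assms(1,2)]) (simp add: assms(3))
  then show ?case
    using assms(1,2) by (intro Suc.IH) (simp only: tensor_power_Suc_left einstein_assoc)
qed

section \<open>Linear dependence of the powers of a tensor\<close>

text \<open>A homogeneous linear system with more unknowns (\<open>L\<close>) than equations (\<open>S\<close>) has a nontrivial
  solution; the proof is Gaussian elimination of one equation.\<close>

lemma homogeneous_system_nontrivial:
  fixes f :: "'l \<Rightarrow> 's \<Rightarrow> 'a::field"
  assumes "finite S" "finite L" "card S < card L"
  shows "\<exists>c. (\<exists>l\<in>L. c l \<noteq> 0) \<and> (\<forall>s\<in>S. (\<Sum>l\<in>L. c l * f l s) = 0)"
  using assms
proof (induction S arbitrary: L f rule: finite_induct)
  case empty
  then have "L \<noteq> {}" by auto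
  then show ?case by (intro exI[of _ "\<lambda>_. 1"]) auto
next
  case (insert s S)
  show ?case
  proof (cases "\<forall>l\<in>L. f l s = 0")
    case True
    have "card S < card L" using insert by simp
    then obtain c where "\<exists>l\<in>L. c l \<noteq> 0" "\<forall>s\<in>S. (\<Sum>l\<in>L. c l * f l s) = 0"
      using insert.IH[of L f] insert.prems(1) by blast
    then show ?thesis using True by (intro exI[of _ c]) auto
  next
    case False
    then obtain p where p: "p \<in> L" "f p s \<noteq> 0" by auto
    define g where "g l t = f l t - f l s / f p s * f p t" for l t
    have "card S < card (L - {p})" using insert p by simp
    then obtain c where c: "\<exists>l\<in>L-{p}. c l \<noteq> 0" "\<forall>t\<in>S. (\<Sum>l\<in>L-{p}. c l * g l t) = 0"
      using insert.IH[of "L - {p}" g] insert.prems(1) by blast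
    define q where "q = - (\<Sum>l\<in>L-{p}. c l * (f l s / f p s))"
    define d where "d = c(p := q)"
    have sum_d: "(\<Sum>l\<in>L. d l * f l t) = (\<Sum>l\<in>L-{p}. c l * g l t)" for t
    proof -
      have "(\<Sum>l\<in>L. d l * f l t) = q * f p t + (\<Sum>l\<in>L-{p}. d l * f l t)"
        using p insert.prems by (simp add: sum.remove[of L p] d_def)
      also have "(\<Sum>l\<in>L-{p}. d l * f l t) = (\<Sum>l\<in>L-{p}. c l * f l t)"
        by (rule sum.cong) (auto simp: d_def)
      also have "q * f p t + \<dots> = (\<Sum>l\<in>L-{p}. c l * g l t)"
        by (simp add: q_def g_def sum_distrib_right sum_subtractf right_diff_distrib
            mult.assoc)
      finally show ?thesis .
    qed
    have "(\<Sum>l\<in>L-{p}. c l * g l s) = 0"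
      using p by (simp add: g_def)
    then have "\<forall>t\<in>insert s S. (\<Sum>l\<in>L. d l * f l t) = 0"
      using c(2) by (simp add: sum_d)
    moreover have "\<exists>l\<in>L. d l \<noteq> 0" using c(1) by (auto simp: d_def)
    ultimately show ?thesis by blast
  qed
qed

text \<open>Some power of \<open>A\<close> is a multiple of the next one, the factor being a polynomial in \<open>A\<close>. Of the
  polynomial form only the commutation with \<open>A\<close> is recorded.\<close>

lemma tensor_power_drop:
  assumes "finite I" "A \<in> tensors I"
  obtains k R where "R \<in> tensors I" "einstein I A R = einstein I R A"
    "tensor_power I A k = einstein I (tensor_power I A (Suc k)) R"
proof -
  define m where "m = card (I \<times> I)"
  have "card (I \<times> I) < card {..m}" by (simp add: m_def)
  then obtain c where c: "\<exists>l\<in>{..m}. c l \<noteq> 0"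
    and sum0: "\<forall>s\<in>I \<times> I. (\<Sum>l\<le>m. c l * tensor_power I A l (fst s) (snd s)) = 0"
    using homogeneous_system_nontrivial[of "I \<times> I" "{..m}"
        "\<lambda>l s. tensor_power I A l (fst s) (snd s)"] assms(1) by auto
  have zero: "(\<Sum>l\<le>m. c l * tensor_power I A l i j) = 0" for i j
    using sum0 tensor_power_in_tensors[OF assms(2)]
    by (cases "(i, j) \<in> I \<times> I") (auto simp: tensors_def)
  \<comment> \<open>Solve the dependency for its lowest term \<open>A\<^sup>k\<close>.\<close>
  define k where "k = (LEAST l. c l \<noteq> 0)"
  have ck: "c k \<noteq> 0" unfolding k_def using c by (metis (mono_tags, lifting) LeastI)
  have below: "c l = 0" if "l < k" for l using that not_less_Least k_def by blast
  have km: "k \<le> m" using c below by (metis atMost_iff not_le order_trans)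
  define R where "R = (\<lambda>i j. \<Sum>l<m-k. (- c (Suc k + l) / c k) * tensor_power I A l i j)"
  have "R \<in> tensors I"
    using tensor_power_in_tensors[OF assms(2)] by (auto simp: R_def tensors_def)
  moreover have "einstein I A R = einstein I R A"
    unfolding R_def einstein_sum_left einstein_sum_right
    using tensor_power_Suc_left[OF assms] by simp
  moreover have "tensor_power I A k = einstein I (tensor_power I A (Suc k)) R"
  proof (intro ext)
    fix i j
    let ?t = "\<lambda>l. c l * tensor_power I A l i j"
    have "(\<Sum>l\<le>m. ?t l) = (\<Sum>l\<in>{k..m}. ?t l)"
      using below by (intro sum.mono_neutral_right) (auto simp: not_le)
    also have "\<dots> = ?t k + (\<Sum>l\<in>{Suc k..<Suc m}. ?t l)"
      using km by (simp add: sum.atLeast_Suc_atMost atLeastLessThanSuc_atLeastAtMost)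
    also have "(\<Sum>l\<in>{Suc k..<Suc m}. ?t l) = (\<Sum>l<m-k. ?t (Suc k + l))"
      using sum.atLeastLessThan_shift_0[of ?t "Suc k" "Suc m"]
      by (simp add: atLeast0LessThan add.commute)
    finally have "c k * tensor_power I A k i j = - (\<Sum>l<m-k. ?t (Suc k + l))"
      using zero[of i j] by (simp add: eq_neg_iff_add_eq_0)
    then have "tensor_power I A k i j = - (\<Sum>l<m-k. ?t (Suc k + l)) / c k"
      using ck by (simp add: field_simps)
    also have "\<dots> = (\<Sum>l<m-k. (- c (Suc k + l) / c k) * tensor_power I A (Suc k + l) i j)"
      by (simp only: sum_negf[symmetric] sum_divide_distrib) (rule sum.cong, simp_all)
    also have "\<dots> = einstein I (tensor_power I A (Suc k)) R i j"
      unfolding R_def einstein_sum_right tensor_power_add[OF assms] ..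
    finally show "tensor_power I A k i j = einstein I (tensor_power I A (Suc k)) R i j" .
  qed
  ultimately show ?thesis using that by blast
qed

section \<open>Core tensors\<close>

lemma einstein_vec_in_tensor_vectors:
  "A \<in> tensors I \<Longrightarrow> einstein_vec I A X \<in> tensor_vectors I"
  by (auto simp: tensors_def einstein_vec_def tensor_vectors_def)

lemma tensor_range_einstein_subset:
  "B \<in> tensors I \<Longrightarrow> tensor_range I (einstein I A B) \<subseteq> tensor_range I A"
  by (auto simp: tensor_range_def einstein_vec_assoc intro: einstein_vec_in_tensor_vectors)

lemma tensor_range_subset_factor:
  assumes "finite I" "A \<in> tensors I" "tensor_range I A \<subseteq> tensor_range I B"
  obtains Y where "A = einstein I B Y"
proof -
  have "\<exists>y. (\<lambda>i. A i j) = einstein_vec I B y" if "j \<in> I" for j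
  proof -
    \<comment> \<open>The \<open>j\<close>-th column of \<open>A\<close> is the image of the \<open>j\<close>-th unit vector.\<close>
    have "(\<lambda>i. A i j) = einstein_vec I A (\<lambda>i. unit_tensor I i j)"
      using einstein_unit_right[OF assms(1,2)]
      by (simp add: einstein_def einstein_vec_def fun_eq_iff)
    moreover have "(\<lambda>i. unit_tensor I i j) \<in> tensor_vectors I"
      by (auto simp: tensor_vectors_def unit_tensor_def)
    ultimately have "(\<lambda>i. A i j) \<in> tensor_range I A"
      unfolding tensor_range_def by blast
    then show ?thesis using assms(3) unfolding tensor_range_def by blast
  qed
  then obtain y where y: "\<And>j. j \<in> I \<Longrightarrow> (\<lambda>i. A i j) = einstein_vec I B (y j)" by metis
  define Y where "Y = (\<lambda>i j. if j \<in> I then y j i else 0)"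
  have "A i j = einstein I B Y i j" for i j
  proof (cases "j \<in> I")
    case True
    then show ?thesis using fun_cong[OF y[OF True], of i]
      by (simp add: einstein_def einstein_vec_def Y_def)
  next
    case False
    then show ?thesis using assms(2) by (simp add: einstein_def Y_def tensors_def)
  qed
  then show ?thesis using that by blast
qed

text \<open>The index is a least number with a property; that some number has it is what makes
  \<open>ind A = 1\<close> informative.\<close>

lemma core_tensor_range:
  assumes "finite I" "A \<in> tensors I" "core_tensor I A"
  shows "tensor_range I A = tensor_range I (einstein I A A)"
proof -
  let ?P = "\<lambda>k. 0 < k \<and>
    tensor_range I (tensor_power I A k) = tensor_range I (tensor_power I A (k + 1))"
  obtain k R where R: "R \<in> tensors I" "einstein I A R = einstein I R A"
    "tensor_power I A k = einstein I (tensor_power I A (Suc k)) R"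
    using tensor_power_drop[OF assms(1,2)] .
  \<comment> \<open>One more factor \<open>A\<close> makes the exponent positive, as the index requires.\<close>
  have "tensor_power I A (Suc k) = einstein I (tensor_power I A (Suc (Suc k))) R"
    using R(3) by (metis tensor_power_Suc_left[OF assms(1,2)] einstein_assoc)
  then have "tensor_range I (tensor_power I A (Suc k)) \<subseteq>
             tensor_range I (tensor_power I A (Suc (Suc k)))"
    by (metis tensor_range_einstein_subset R(1))
  moreover have "tensor_range I (tensor_power I A (Suc (Suc k))) \<subseteq>
                 tensor_range I (tensor_power I A (Suc k))"
    using tensor_range_einstein_subset[OF assms(2), of "tensor_power I A (Suc k)"] by simp
  ultimately have "?P (Suc k)" by simp
  then have "?P (LEAST k. ?P k)" by (rule LeastI)
  then have "?P 1"
    using assms(3) by (simp add: core_tensor_def tensor_ind_def)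
  then show ?thesis
    using assms(1,2) by (simp add: einstein_unit_left)
qed

text \<open>A core tensor has a commuting inner inverse. In the proof \<open>A = A\<^sup>k\<^sup>+\<^sup>1 W\<close> transfers
  \<open>A\<^sup>k\<^sup>+\<^sup>1 = A R A\<^sup>k\<^sup>+\<^sup>1\<close> to \<open>A\<close> itself.\<close>

lemma core_tensor_commuting_inverse:
  assumes "finite I" "A \<in> tensors I" "core_tensor I A"
  obtains R where "R \<in> tensors I" "einstein I A R = einstein I R A"
    "einstein I A (einstein I A R) = A"
proof -
  obtain Y where Y: "A = einstein I (einstein I A A) Y"
    using tensor_range_subset_factor[OF assms(1,2)] core_tensor_range[OF assms] by blast
  have iter: "\<exists>W. A = einstein I (tensor_power I A (Suc k)) W" for k
  proof (induction k)
    case 0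
    show ?case
      using assms
      by (auto simp: einstein_unit_left einstein_unit_right intro: exI[of _ "unit_tensor I"])
  next
    case (Suc k)
    then obtain W where W: "A = einstein I (tensor_power I A (Suc k)) W" by blast
    have "tensor_power I A (Suc k) = einstein I (tensor_power I A (Suc (Suc k))) Y"
      using Y by (simp add: einstein_assoc)
    then have "A = einstein I (tensor_power I A (Suc (Suc k))) (einstein I Y W)"
      using W by (metis einstein_assoc)
    then show ?case by blast
  qed
  obtain k R where R: "R \<in> tensors I" "einstein I A R = einstein I R A"
    and drop: "tensor_power I A k = einstein I (tensor_power I A (Suc k)) R"
    using tensor_power_drop[OF assms(1,2)] .
  have comm: "einstein I (tensor_power I A l) R = einstein I R (tensor_power I A l)" for l
  proof (induction l)
    case 0
    then show ?case using assms(1) R(1) by (simp add: einstein_unit_left einstein_unit_right)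
  next
    case (Suc l)
    then show ?case using R(2) by (simp, metis einstein_assoc)
  qed
  obtain W where W: "A = einstein I (tensor_power I A (Suc k)) W" using iter by blast
  have "tensor_power I A (Suc k) = einstein I (einstein I A R) (tensor_power I A (Suc k))"
    unfolding tensor_power_Suc_left[OF assms(1,2), of k]
    using drop comm[of "Suc k"] R(2)
    by (metis einstein_assoc tensor_power_Suc_left[OF assms(1,2)])
  then have "A = einstein I (einstein I A R) A"
    using W by (metis einstein_assoc)
  then have "einstein I A (einstein I A R) = A"
    using R(2) by (metis einstein_assoc)
  then show ?thesis using that R by blast
qed

text \<open>The normal equation \<open>A\<^sup>* A Z = A\<^sup>*\<close> always has a solution.\<close>

lemma normal_equation_solvable:
  assumes "finite I" "A \<in> tensors I"
  obtains Z where "Z \<in> tensors I"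
    "einstein I (conj_transpose A) (einstein I A Z) = conj_transpose A"
proof -
  define H where "H = einstein I (conj_transpose A) A"
  have H: "H \<in> tensors I" "conj_transpose H = H"
    using assms(2) by (auto simp: H_def einstein_in_tensors conj_transpose_in_tensors
        conj_transpose_einstein conj_transpose_conj_transpose)
  obtain k R where R: "R \<in> tensors I" "einstein I H R = einstein I R H"
    and drop: "tensor_power I H k = einstein I (tensor_power I H (Suc k)) R"
    using tensor_power_drop[OF assms(1) H(1)] .
  have "einstein I (tensor_power I H (Suc k)) (unit_tensor I) =
        einstein I (tensor_power I H (Suc k)) (einstein I H R)"
    using drop assms(1) H(1)
    by (simp only: einstein_unit_right tensor_power_in_tensors tensor_power.simps
        einstein_assoc R(2)) (metis einstein_assoc R(2))
  then have "einstein I H (unit_tensor I) = einstein I H (einstein I H R)"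
    by (rule hermitian_power_cancel[OF assms(1) H])
  then have "einstein I A (unit_tensor I) = einstein I A (einstein I H R)"
    by (intro conj_transpose_cancel[OF assms]) (simp add: H_def einstein_assoc)
  then have "A = einstein I A (einstein I R H)"
    using assms by (simp add: einstein_unit_right R(2))
  then have "conj_transpose A = einstein I H (einstein I (conj_transpose R) (conj_transpose A))"
    by (metis conj_transpose_einstein einstein_assoc H(2))
  then show ?thesis
    using that[of "einstein I (conj_transpose R) (conj_transpose A)"] R(1) assms(2)
    by (simp add: H_def einstein_assoc einstein_in_tensors conj_transpose_in_tensors)
qed

lemma hermitian_inner_inverse:
  assumes "finite I" "A \<in> tensors I"
  obtains Z where "Z \<in> tensors I" "conj_transpose (einstein I A Z) = einstein I A Z"
    "einstein I A (einstein I Z A) = A"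
proof -
  obtain Z where Z: "Z \<in> tensors I"
    and ne: "einstein I (conj_transpose A) (einstein I A Z) = conj_transpose A"
    using normal_equation_solvable[OF assms] .
  let ?E = "einstein I A Z"
  \<comment> \<open>Multiplying the normal equation by \<open>Z\<^sup>*\<close> shows that \<open>E = A Z\<close> satisfies \<open>E\<^sup>* E = E\<^sup>*\<close>.\<close>
  have EE: "einstein I (conj_transpose ?E) ?E = conj_transpose ?E"
    by (simp add: conj_transpose_einstein einstein_assoc ne)
  have herm: "conj_transpose ?E = ?E"
    using EE by (metis conj_transpose_einstein conj_transpose_conj_transpose)
  have "A = conj_transpose (einstein I (conj_transpose A) ?E)"
    by (simp add: ne conj_transpose_conj_transpose)
  then have "einstein I A (einstein I Z A) = A"
    by (simp only: conj_transpose_einstein[of I "conj_transpose A"] herm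
        conj_transpose_conj_transpose einstein_assoc)
  then show ?thesis using that Z herm by blast
qed

section \<open>Existence and uniqueness of core inverses\<close>

lemma is_core_inverse_alt:
  assumes "finite I" "A \<in> tensors I"
  shows "is_core_inverse I A X \<longleftrightarrow> X \<in> tensors I \<and>
    conj_transpose (einstein I A X) = einstein I A X \<and>
    einstein I X (einstein I A A) = A \<and> einstein I A (einstein I X X) = X"
  using assms by (auto simp: is_core_inverse_def tensor_power_2)

text \<open>The core inverse is \<open>A R Z\<close>: by \<open>A\<^sup>2 R = A\<close>, its product with \<open>A\<close> is the orthogonal projector
  \<open>A Z\<close> onto the range of \<open>A\<close>.\<close>

lemma core_tensor_has_core_inverse:
  assumes "finite I" "A \<in> tensors I" "core_tensor I A"
  shows "\<exists>X. is_core_inverse I A X"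
proof -
  obtain R where R: "R \<in> tensors I" "einstein I A R = einstein I R A"
    "einstein I A (einstein I A R) = A"
    using core_tensor_commuting_inverse[OF assms] .
  obtain Z where Z: "Z \<in> tensors I" "conj_transpose (einstein I A Z) = einstein I A Z"
    "einstein I A (einstein I Z A) = A"
    using hermitian_inner_inverse[OF assms(1,2)] .
  let ?X = "einstein I A (einstein I R Z)"
  have AX: "einstein I A ?X = einstein I A Z"
    using R(3) by (metis einstein_assoc)
  have "?X \<in> tensors I"
    using assms(2) R(1) Z(1) by (simp add: einstein_in_tensors)
  moreover have "einstein I ?X (einstein I A A) = A"
  proof -
    have "einstein I ?X (einstein I A A) =
          einstein I R (einstein I (einstein I A (einstein I Z A)) A)"
      using R(2) by (metis einstein_assoc)
    also have "\<dots> = einstein I A (einstein I A R)"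
      unfolding Z(3) using R(2) by (metis einstein_assoc)
    finally show ?thesis using R(3) by simp
  qed
  moreover have "einstein I A (einstein I ?X ?X) = ?X"
  proof -
    have "einstein I A (einstein I ?X ?X) = einstein I (einstein I A Z) ?X"
      by (simp only: AX einstein_assoc[of I A ?X ?X, symmetric])
    also have "\<dots> = einstein I (einstein I A (einstein I Z A)) (einstein I R Z)"
      by (simp add: einstein_assoc)
    finally show ?thesis by (simp add: Z(3))
  qed
  ultimately show ?thesis
    using Z(2) AX is_core_inverse_alt[OF assms(1,2)] by auto
qed

lemma is_core_inverse_unique:
  assumes "finite I" "A \<in> tensors I" "is_core_inverse I A X" "is_core_inverse I A Y"
  shows "X = Y"
proof -
  have X: "conj_transpose (einstein I A X) = einstein I A X"
    "einstein I X (einstein I A A) = A" "einstein I A (einstein I X X) = X"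
    and Y: "conj_transpose (einstein I A Y) = einstein I A Y"
    "einstein I Y (einstein I A A) = A" "einstein I A (einstein I Y Y) = Y"
    using assms is_core_inverse_alt by blast+
  have inner: "einstein I A (einstein I V A) = A"
    if "einstein I V (einstein I A A) = A" "einstein I A (einstein I V V) = V" for V
    using that by (metis einstein_assoc)
  have XY: "einstein I (einstein I A X) (einstein I A Y) = einstein I A Y"
    using inner[OF X(2,3)] by (metis einstein_assoc)
  have YX: "einstein I (einstein I A Y) (einstein I A X) = einstein I A X"
    using inner[OF Y(2,3)] by (metis einstein_assoc)
  \<comment> \<open>\<open>A X\<close> and \<open>A Y\<close> are both the orthogonal projector onto the range of \<open>A\<close>.\<close>
  have P: "einstein I A X = einstein I A Y"
    using arg_cong[OF XY, of conj_transpose] YX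
    by (simp only: conj_transpose_einstein[of I "einstein I A X"] X(1) Y(1))
  have "X = einstein I X (einstein I A X)"
    using X(2,3) by (metis einstein_assoc)
  also have "\<dots> = einstein I X (einstein I A Y)" by (simp only: P)
  also have "\<dots> = Y" using X(2) Y(3) by (metis einstein_assoc)
  finally show ?thesis .
qed

lemma core_inverse_eqI:
  assumes "finite I" "A \<in> tensors I" "is_core_inverse I A X"
  shows "core_inverse I A = X"
  unfolding core_inverse_def
  using assms is_core_inverse_unique[OF assms(1,2)] by (intro the_equality) blast+

section \<open>Kronecker products\<close>

lemma einstein_kronecker:
  "einstein (I \<times> J) (kronecker A B) (kronecker C D) =
   kronecker (einstein I A C) (einstein J B D)"
proof (intro ext)
  fix p q :: "'a \<times> 'b"
  obtain i k j l where pq: "p = (i, k)" "q = (j, l)" by (metis surj_pair)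
  have "einstein (I \<times> J) (kronecker A B) (kronecker C D) p q =
        (\<Sum>(s, t)\<in>I \<times> J. (A i s * C s j) * (B k t * D t l))"
    by (simp add: einstein_def kronecker_def pq case_prod_unfold algebra_simps)
  also have "\<dots> = (\<Sum>s\<in>I. A i s * C s j) * (\<Sum>t\<in>J. B k t * D t l)"
    by (simp add: sum_product sum.cartesian_product)
  finally show "einstein (I \<times> J) (kronecker A B) (kronecker C D) p q =
                kronecker (einstein I A C) (einstein J B D) p q"
    by (simp add: einstein_def kronecker_def pq)
qed

lemma conj_transpose_kronecker:
  "conj_transpose (kronecker A B) = kronecker (conj_transpose A) (conj_transpose B)"
  by (simp add: conj_transpose_def kronecker_def fun_eq_iff)

lemma kronecker_in_tensors:
  "A \<in> tensors I \<Longrightarrow> B \<in> tensors J \<Longrightarrow> kronecker A B \<in> tensors (I \<times> J)"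
  by (auto simp: tensors_def kronecker_def)

lemma is_core_inverse_kronecker:
  assumes "finite I" "finite J" "A \<in> tensors I" "B \<in> tensors J"
    and "is_core_inverse I A X" "is_core_inverse J B Y"
  shows "is_core_inverse (I \<times> J) (kronecker A B) (kronecker X Y)"
  using assms
  by (simp add: is_core_inverse_alt kronecker_in_tensors einstein_kronecker
      conj_transpose_kronecker)

theorem theorem4p5:
  fixes n :: nat and N :: "nat \<Rightarrow> nat"
    and A B :: "(nat \<Rightarrow> nat) tensor"
  assumes "1 \<le> n" and "\<forall>k\<in>{1..n}. 1 \<le> N k"
    and "A \<in> tensors (multi_indices n N)" and "B \<in> tensors (multi_indices n N)"
    and "core_tensor (multi_indices n N) A" and "core_tensor (multi_indices n N) B"
  shows "(\<exists>!X. is_core_inverse (multi_indices n N \<times> multi_indices n N) (kronecker A B) X) \<and>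
         core_inverse (multi_indices n N \<times> multi_indices n N) (kronecker A B) =
           kronecker (core_inverse (multi_indices n N) A) (core_inverse (multi_indices n N) B)"
proof -
  let ?I = "multi_indices n N"
  have fin: "finite ?I" by (simp add: multi_indices_def finite_PiE)
  then have fin2: "finite (?I \<times> ?I)" by simp
  have AB: "kronecker A B \<in> tensors (?I \<times> ?I)"
    using assms(3,4) by (rule kronecker_in_tensors)
  obtain X Y where X: "is_core_inverse ?I A X" and Y: "is_core_inverse ?I B Y"
    using core_tensor_has_core_inverse fin assms(3-6) by metis
  have XY: "is_core_inverse (?I \<times> ?I) (kronecker A B) (kronecker X Y)"
    using fin fin assms(3,4) X Y by (rule is_core_inverse_kronecker)
  then have "\<exists>!X. is_core_inverse (?I \<times> ?I) (kronecker A B) X"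
    using is_core_inverse_unique[OF fin2 AB] by blast
  then show ?thesis
    using core_inverse_eqI[OF fin2 AB XY] core_inverse_eqI[OF fin assms(3) X]
      core_inverse_eqI[OF fin assms(4) Y] by simp
qed

end
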